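(* For all names $P,Q,R,S$: if $\eta\,P\,\mathrm{Solid}$, $\eta\,Q\,\mathrm{Solid}$, $\mathrm{InteriorPoint}(P)\subseteq\mathrm{InteriorPoint}(Q)$, $\eta\,R\,(\mathrm{klass}(\mathrm{InteriorPoint}(P)))$ and $\eta\,S\,(\mathrm{klass}(\mathrm{InteriorPoint}(Q)))$, then $\eta\,R\,(\mathrm{pt}(S))$.
   Context: Logic is classical. Names form a type $N$; a name may designate zero, one or several objects. The relation $\eta : N\to N\to \mathrm{Prop}$ (singular inclusion) is governed by Leśniewski's Ontology: $\eta\,A\,b$ holds iff [there is $C$ with $\eta\,C\,A$] and [for all $C,D$, $\eta\,C\,A$ and $\eta\,D\,A$ imply $\eta\,C\,D$] and [for all $C$, $\eta\,C\,A$ implies $\eta\,C\,b$]; i.e. $A$ designates exactly one object, which is among those designated by $b$. $A$ is an Individual iff $\eta\,A\,A$. Notation: $P\equiv Q$ iff $\eta\,P\,Q$ and $\eta\,Q\,P$; $a\approx b$ iff $\forall P,\ \eta\,P\,a\leftrightarrow\eta\,P\,b$; $a\subseteq b$ iff $\forall P,\ \eta\,P\,a\to\eta\,P\,b$. Names with the same extension are interchangeable. Name-forming operators are introduced by stating when $\eta\,P\,(\cdot)$ holds. Mereology: $\eta\,P\,(\mathrm{pt}(Q))$ ("$P$ is a part of $Q$") relates individuals and is reflexive on individuals, transitive, and antisymmetric up to $\equiv$; $\eta\,P\,(\mathrm{ppt}(Q))$ (proper part) means $\eta\,P\,(\mathrm{pt}(Q))$ and not $P\equiv Q$; $\eta\,P\,(\mathrm{ext}(Q))$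 means $P,Q$ are individuals with no common part. $\eta\,A\,(\mathrm{klass}(a))$ iff $A$ is an Individual, every $B$ with $\eta\,B\,a$ satisfies $\eta\,B\,(\mathrm{pt}(A))$, and for every $B$ with $\eta\,B\,(\mathrm{pt}(A))$ there exist $C,D$ with $\eta\,C\,a$, $\eta\,D\,(\mathrm{pt}(C))$, $\eta\,D\,(\mathrm{pt}(B))$. If some $C$ satisfies $\eta\,C\,a$, then there is $A$ with $\eta\,A\,(\mathrm{klass}(a))$, unique up to $\equiv$. (In particular the mereology is extensional: if every part of an individual $A$ shares a part with the individual $B$, then $A$ is a part of $B$.) Geometry: $\mathrm{balls}$ is a primitive name whose members are individuals (balls); at least one ball exists. $\eta\,P\,(\mathrm{Concent}(Q))$ means that the balls $P,Q$ are concentric in Tarski's sense: $P\equiv Q$; or $P$ is a proper part of $Q$ and any two balls $X,Y$ externally diametrical to $P$ and internally tangent to $Q$ are internally diametrical to $Q$; or the same with $P,Q$ exchanged. Here (all variables balls): $A$ is externally tangent to $B$ if $A$ is external to $B$ and of any two balls $X,Y$ having $A$ as part and external to $B$ one is part of the other; $A$ is internally tangent to $B$ if $A$ is a proper part of $B$ and of any two balls $X,Y$ having $A$ as part and being parts of $B$ one is part of the other; $A,B$ are externally diametrical to $C$ if both are externally tangent to $C$ and whenever $X,Y$ are external to $C$, $A$ is part of $X$ and $B$ is part of $Y$, then $X$ is external to $Y$; $A,B$ are internally diametrical to $C$ if both are internally tangent to $C$ and whenever $X,Y$ are external to $C$, $A$ is externally tangent to $X$ and $B$ to $Y$, then $X$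 is external to $Y$. $\eta\,P\,(\mathrm{Point}(Q))$ iff $\eta\,P\,\mathrm{balls}$, $\eta\,Q\,\mathrm{balls}$ and $\eta\,P\,(\mathrm{Concent}(Q))$. Standing assumptions: concentricity is an equivalence relation on balls, and concentric balls $P,Q$ satisfy $\mathrm{Point}(P)\approx\mathrm{Point}(Q)$. $\eta\,P\,\mathrm{Solid}$ iff $P$ is an Individual and there is $b\subseteq\mathrm{balls}$ with $\eta\,P\,(\mathrm{klass}(b))$; parts of solids are assumed to be solids. $\eta\,P\,(\mathrm{InteriorPoint}(Q))$ iff $\eta\,Q\,\mathrm{Solid}$ and there is $P'$ with $\eta\,P\,(\mathrm{Point}(P'))$ and $\eta\,P'\,(\mathrm{pt}(Q))$. *)

theory Defs
  imports Main
begin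

class names =
  fixes eta :: "'a \<Rightarrow> 'a \<Rightarrow> bool"  ("\<eta>")
begin

definition individual :: "'a \<Rightarrow> bool" where
  "individual A \<longleftrightarrow> \<eta> A A"

text \<open>The infix symbols below stand for singular identity, coextensiveness and
  weak inclusion of names; \<open>\<equiv>\<close> and \<open>\<subseteq>\<close> are already taken by the logic and by sets.\<close>

definition singular_eq :: "'a \<Rightarrow> 'a \<Rightarrow> bool"  (infix "\<simeq>" 50) where
  "P \<simeq> Q \<longleftrightarrow> \<eta> P Q \<and> \<eta> Q P"

definition coextensive :: "'a \<Rightarrow> 'a \<Rightarrow> bool"  (infix "\<approx>" 50) where
  "a \<approx> b \<longleftrightarrow> (\<forall>P. \<eta> P a \<longleftrightarrow> \<eta> P b)"

definition weakly_included :: "'a \<Rightarrow> 'a \<Rightarrow> bool"  (infix "\<sqsubseteq>" 50) where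
  "a \<sqsubseteq> b \<longleftrightarrow> (\<forall>P. \<eta> P a \<longrightarrow> \<eta> P b)"

end

text \<open>Interchangeability of coextensive names in every context is, in HOL, equality.\<close>

class ontology = names +
  assumes ontology:
    "\<eta> A b \<longleftrightarrow>
       (\<exists>C. \<eta> C A) \<and>
       (\<forall>C D. \<eta> C A \<and> \<eta> D A \<longrightarrow> \<eta> C D) \<and>
       (\<forall>C. \<eta> C A \<longrightarrow> \<eta> C b)"
    and interchangeable: "a \<approx> b \<Longrightarrow> a = b"

text \<open>A name-forming operator is a class parameter whose extension is fixed by an axiom
  saying when \<open>\<eta> P (\<dots>)\<close> holds; no general comprehension principle for names is assumed.
  Without one, \<open>mereology_extensional\<close> does not follow from the existence and
  uniqueness of classes (the usual argument forms the class of a name whose members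
  are exactly two given individuals), so it is listed as an axiom.\<close>

class mereology = ontology +
  fixes pt :: "'a \<Rightarrow> 'a"
    and ppt :: "'a \<Rightarrow> 'a"
    and ext :: "'a \<Rightarrow> 'a"
    and klass :: "'a \<Rightarrow> 'a"
  assumes pt_individuals: "\<eta> P (pt Q) \<Longrightarrow> individual P \<and> individual Q"
    and pt_refl: "individual P \<Longrightarrow> \<eta> P (pt P)"
    and pt_trans: "\<eta> P (pt Q) \<Longrightarrow> \<eta> Q (pt R) \<Longrightarrow> \<eta> P (pt R)"
    and pt_antisym: "\<eta> P (pt Q) \<Longrightarrow> \<eta> Q (pt P) \<Longrightarrow> P \<simeq> Q"
    and eta_ppt: "\<eta> P (ppt Q) \<longleftrightarrow> \<eta> P (pt Q) \<and> \<not> P \<simeq> Q"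
    and eta_ext: "\<eta> P (ext Q) \<longleftrightarrow>
      individual P \<and> individual Q \<and> \<not> (\<exists>R. \<eta> R (pt P) \<and> \<eta> R (pt Q))"
    and eta_klass: "\<eta> A (klass a) \<longleftrightarrow>
      individual A \<and>
      (\<forall>B. \<eta> B a \<longrightarrow> \<eta> B (pt A)) \<and>
      (\<forall>B. \<eta> B (pt A) \<longrightarrow> (\<exists>C D. \<eta> C a \<and> \<eta> D (pt C) \<and> \<eta> D (pt B)))"
    and klass_exists: "\<eta> C a \<Longrightarrow> \<exists>A. \<eta> A (klass a)"
    and klass_unique: "\<eta> A (klass a) \<Longrightarrow> \<eta> B (klass a) \<Longrightarrow> A \<simeq> B"
    and mereology_extensional:
      "individual A \<Longrightarrow> individual B \<Longrightarrow>
       (\<forall>C. \<eta> C (pt A) \<longrightarrow> (\<exists>D. \<eta> D (pt C) \<and> \<eta> D (pt B))) \<Longrightarrow> \<eta> A (pt B)"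

class ball_mereology = mereology +
  fixes balls :: 'a
  assumes ball_exists: "\<exists>B. \<eta> B balls"
begin

definition externally_tangent :: "'a \<Rightarrow> 'a \<Rightarrow> bool" where
  "externally_tangent A B \<longleftrightarrow>
     \<eta> A balls \<and> \<eta> B balls \<and> \<eta> A (ext B) \<and>
     (\<forall>X Y. \<eta> X balls \<and> \<eta> Y balls \<and>
        \<eta> A (pt X) \<and> \<eta> X (ext B) \<and> \<eta> A (pt Y) \<and> \<eta> Y (ext B) \<longrightarrow>
        \<eta> X (pt Y) \<or> \<eta> Y (pt X))"

definition internally_tangent :: "'a \<Rightarrow> 'a \<Rightarrow> bool" where
  "internally_tangent A B \<longleftrightarrow>
     \<eta> A balls \<and> \<eta> B balls \<and> \<eta> A (ppt B) \<and>
     (\<forall>X Y. \<eta> X balls \<and> \<eta> Y balls \<and>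
        \<eta> A (pt X) \<and> \<eta> X (pt B) \<and> \<eta> A (pt Y) \<and> \<eta> Y (pt B) \<longrightarrow>
        \<eta> X (pt Y) \<or> \<eta> Y (pt X))"

definition externally_diametrical :: "'a \<Rightarrow> 'a \<Rightarrow> 'a \<Rightarrow> bool" where
  "externally_diametrical A B C \<longleftrightarrow>
     externally_tangent A C \<and> externally_tangent B C \<and>
     (\<forall>X Y. \<eta> X balls \<and> \<eta> Y balls \<and>
        \<eta> X (ext C) \<and> \<eta> Y (ext C) \<and> \<eta> A (pt X) \<and> \<eta> B (pt Y) \<longrightarrow> \<eta> X (ext Y))"

definition internally_diametrical :: "'a \<Rightarrow> 'a \<Rightarrow> 'a \<Rightarrow> bool" where
  "internally_diametrical A B C \<longleftrightarrow>
     internally_tangent A C \<and> internally_tangent B C \<and>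
     (\<forall>X Y. \<eta> X balls \<and> \<eta> Y balls \<and>
        \<eta> X (ext C) \<and> \<eta> Y (ext C) \<and>
        externally_tangent A X \<and> externally_tangent B Y \<longrightarrow> \<eta> X (ext Y))"

definition properly_concentric :: "'a \<Rightarrow> 'a \<Rightarrow> bool" where
  "properly_concentric P Q \<longleftrightarrow>
     \<eta> P (ppt Q) \<and>
     (\<forall>X Y. \<eta> X balls \<and> \<eta> Y balls \<and> externally_diametrical X Y P \<and>
        internally_tangent X Q \<and> internally_tangent Y Q \<longrightarrow>
        internally_diametrical X Y Q)"

end

class tarski_geometry = ball_mereology +
  fixes Concent :: "'a \<Rightarrow> 'a"
    and Point :: "'a \<Rightarrow> 'a"
    and Solid :: 'a
    and InteriorPoint :: "'a \<Rightarrow> 'a"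
  assumes eta_Concent: "\<eta> P (Concent Q) \<longleftrightarrow>
      \<eta> P balls \<and> \<eta> Q balls \<and>
      (P \<simeq> Q \<or> properly_concentric P Q \<or> properly_concentric Q P)"
    and eta_Point: "\<eta> P (Point Q) \<longleftrightarrow> \<eta> P balls \<and> \<eta> Q balls \<and> \<eta> P (Concent Q)"
    and Concent_refl: "\<eta> P balls \<Longrightarrow> \<eta> P (Concent P)"
    and Concent_sym: "\<eta> P (Concent Q) \<Longrightarrow> \<eta> Q (Concent P)"
    and Concent_trans:
      "\<eta> P (Concent Q) \<Longrightarrow> \<eta> Q (Concent R) \<Longrightarrow> \<eta> P (Concent R)"
    and Point_Concent: "\<eta> P (Concent Q) \<Longrightarrow> Point P \<approx> Point Q"
    and eta_Solid: "\<eta> P Solid \<longleftrightarrow>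
      individual P \<and> (\<exists>b. b \<sqsubseteq> balls \<and> \<eta> P (klass b))"
    and part_of_Solid: "\<eta> P Solid \<Longrightarrow> \<eta> Q (pt P) \<Longrightarrow> \<eta> Q Solid"
    and eta_InteriorPoint: "\<eta> P (InteriorPoint Q) \<longleftrightarrow>
      \<eta> Q Solid \<and> (\<exists>P'. \<eta> P (Point P') \<and> \<eta> P' (pt Q))"

end

theory Submission
  imports Defs
begin

text \<open>Forming classes is monotone in the name, whatever the name designates, and the theorem
  is the instance for interior points. A part of the smaller class meets some member of the
  smaller name; that member belongs to the larger name and so lies in the larger class. Hence
  every part of the smaller class meets the larger one, and extensionality turns this
  overlap into parthood.\<close>

lemma klass_mono:
  fixes a b A B :: "'n :: mereology"
  assumes incl: "a \<sqsubseteq> b"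
    and A: "\<eta> A (klass a)"
    and B: "\<eta> B (klass b)"
  shows "\<eta> A (pt B)"
proof (rule mereology_extensional)
  show "individual A" "individual B"
    using A B by (simp_all add: eta_klass)
  show "\<forall>C. \<eta> C (pt A) \<longrightarrow> (\<exists>D. \<eta> D (pt C) \<and> \<eta> D (pt B))"
  proof (intro allI impI)
    fix C
    assume "\<eta> C (pt A)"
    then obtain M D where "\<eta> M a" and DM: "\<eta> D (pt M)" and DC: "\<eta> D (pt C)"
      using A unfolding eta_klass by blast
    from \<open>\<eta> M a\<close> incl have "\<eta> M b"
      by (simp add: weakly_included_def)
    then have "\<eta> M (pt B)"
      using B by (simp add: eta_klass)
    with DM have "\<eta> D (pt B)"
      by (rule pt_trans)
    with DC show "\<exists>D. \<eta> D (pt C) \<and> \<eta> D (pt B)"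
      by blast
  qed
qed

theorem theorem10:
  fixes P Q R S :: "'n :: tarski_geometry"
  assumes "\<eta> P Solid"
    and "\<eta> Q Solid"
    and "InteriorPoint P \<sqsubseteq> InteriorPoint Q"
    and "\<eta> R (klass (InteriorPoint P))"
    and "\<eta> S (klass (InteriorPoint Q))"
  shows "\<eta> R (pt S)"
  using assms(3-5) by (rule klass_mono)

end
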